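(* Let $(\mathcal{L}_n)_{n\ge 0}$ be a Lucas-type sequence with data $p_0,p_1,d,g,\alpha$, and let $(\mathcal{F}_n)_{n\ge0}$ be the equivalent Fibonacci-type sequence, determined by the same $d$ and $g$ (as defined in the context). Write $(a-b)^2=d^2+4g$, and let $'$ denote the derivative with respect to $x$. If $g$ is a constant, then for every integer $n\ge 1$: (i) $$\mathcal{F}_n'=\frac{d'\left(n g\,\mathcal{F}_{n-1}-d\,\mathcal{F}_n+n\,\mathcal{F}_{n+1}\right)}{(a-b)^2}=\frac{d'\left(n\alpha\,\mathcal{L}_n-d\,\mathcal{F}_n\right)}{(a-b)^2};$$ (ii) $$\mathcal{L}_n'=\frac{n\,d'\,\mathcal{F}_n}{\alpha}.$$
   Context: A Lucas-type sequence is given by a constant $p_0$ with $|p_0|\in\{1,2\}$, the integer $\alpha=2/p_0$, and non-zero polynomials $p_1,d,g\in\mathbb{Q}[x]$ with $d=\alpha p_1$, via $\mathcal{L}_0=p_0$, $\mathcal{L}_1=p_1$, $\mathcal{L}_n=d\,\mathcal{L}_{n-1}+g\,\mathcal{L}_{n-2}$ for $n\ge 2$. The equivalent Fibonacci-type sequence is $\mathcal{F}_0=0$, $\mathcal{F}_1=1$, $\mathcal{F}_n=d\,\mathcal{F}_{n-1}+g\,\mathcal{F}_{n-2}$ for $n\ge 2$. Here $a,b$ are the two solutions of $z^2-dz-g=0$, so $a+b=d$, $ab=-g$, and $(a-b)^2=d^2+4g$ is a non-zero polynomial; the identities in (i) are identities of rational functions. Standing assumptions: $\gcd(d,g)=1$,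 $\deg(g)<\deg(d)$, $\gcd(p_0,p_1)=\gcd(p_0,d)=\gcd(p_0,g)=1$, and $\deg(\mathcal{L}_1)\ge 1$. *)

theory Defs
  imports
    "HOL-Computational_Algebra.Computational_Algebra"
    "HOL-Algebra.Algebraic_Closure_Type"
begin

definition lucas_type :: "rat \<Rightarrow> int \<Rightarrow> rat poly \<Rightarrow> rat poly \<Rightarrow> rat poly \<Rightarrow> bool" where
  "lucas_type p0 \<alpha> p1 d g \<longleftrightarrow>
     \<bar>p0\<bar> \<in> {1, 2} \<and> of_int \<alpha> = 2 / p0 \<and>
     p1 \<noteq> 0 \<and> d \<noteq> 0 \<and> g \<noteq> 0 \<and> d = of_int \<alpha> * p1"

fun lucas :: "rat \<Rightarrow> rat poly \<Rightarrow> rat poly \<Rightarrow> rat poly \<Rightarrow> nat \<Rightarrow> rat poly" where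
  "lucas p0 p1 d g 0 = [:p0:]"
| "lucas p0 p1 d g (Suc 0) = p1"
| "lucas p0 p1 d g (Suc (Suc n)) = d * lucas p0 p1 d g (Suc n) + g * lucas p0 p1 d g n"

fun fibonacci :: "rat poly \<Rightarrow> rat poly \<Rightarrow> nat \<Rightarrow> rat poly" where
  "fibonacci d g 0 = 0"
| "fibonacci d g (Suc 0) = 1"
| "fibonacci d g (Suc (Suc n)) = d * fibonacci d g (Suc n) + g * fibonacci d g n"

text \<open>
  The roots of \<open>z\<^sup>2 - d z - g\<close> need not be rational functions, so they are taken in the algebraic
  closure of the field of rational functions over the rationals. As the embedding below
  is injective, an identity between embedded quotients is an identity of rational functions.
\<close>

definition emb :: "rat poly \<Rightarrow> rat poly fract alg_closure" where
  "emb p = to_ac (to_fract p)"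

definition char_roots :: "rat poly \<Rightarrow> rat poly \<Rightarrow> rat poly fract alg_closure set" where
  "char_roots d g = {z. z\<^sup>2 - emb d * z - emb g = 0}"

lemma emb_simps [simp]:
  "emb 0 = 0" "emb 1 = 1"
  "emb (p + q) = emb p + emb q" "emb (p - q) = emb p - emb q" "emb (- p) = - emb p"
  "emb (p * q) = emb p * emb q"
  by (simp_all add: emb_def)

lemma emb_power [simp]: "emb (p ^ k) = emb p ^ k"
  by (induction k) simp_all

lemma emb_of_nat [simp]: "emb (of_nat k) = of_nat k"
  by (induction k) simp_all

lemma emb_numeral [simp]: "emb (numeral m) = numeral m"
  using emb_of_nat[of "numeral m"] by (simp del: emb_of_nat)

lemma emb_eq_iff: "emb p = emb q \<longleftrightarrow> p = q"
  by (simp add: emb_def)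

lemma char_roots_eq:
  assumes "z \<in> char_roots d g"
  shows "char_roots d g = {z, emb d - z}"
proof -
  have z: "emb g = z\<^sup>2 - emb d * z"
    using assms by (simp add: char_roots_def)
  have "w \<in> char_roots d g \<longleftrightarrow> w \<in> {z, emb d - z}" for w
  proof -
    have "w\<^sup>2 - emb d * w - emb g = (w - z) * (w - (emb d - z))"
      unfolding z by (simp add: algebra_simps power2_eq_square)
    then have "w \<in> char_roots d g \<longleftrightarrow> (w - z) * (w - (emb d - z)) = 0"
      unfolding char_roots_def by (simp only: mem_Collect_eq)
    then show ?thesis
      by (simp only: mult_eq_0_iff right_minus_eq insert_iff empty_iff simp_thms)
  qed
  then show ?thesis by blast
qed

lemma exists_char_roots: "\<exists>a b. char_roots d g = {a, b}"
proof -
  obtain z where "poly [:- emb g, - emb d, 1:] z = 0"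
    using alg_closed_imp_poly_has_root[of "[:- emb g, - emb d, 1:]"] by auto
  then have "z \<in> char_roots d g"
    by (simp add: char_roots_def algebra_simps power2_eq_square)
  then show ?thesis
    using char_roots_eq by blast
qed

lemma char_roots_vieta:
  assumes "char_roots d g = {a, b}"
  shows "a + b = emb d" "a * b = - emb g"
proof -
  have a: "a \<in> char_roots d g"
    using assms by simp
  have "{a, emb d - a} = {a, b}"
    using char_roots_eq[OF a] assms by simp
  then have b: "b = emb d - a"
    by (auto simp: doubleton_eq_iff)
  then show "a + b = emb d"
    by simp
  show "a * b = - emb g"
    using a unfolding b by (simp add: char_roots_def algebra_simps power2_eq_square)
qed

lemma char_roots_diff_square:
  assumes "char_roots d g = {a, b}"
  shows "(a - b)\<^sup>2 = emb (d\<^sup>2 + 4 * g)"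
proof -
  have "(a - b)\<^sup>2 = (a + b)\<^sup>2 - 4 * (a * b)"
    by (simp add: algebra_simps power2_eq_square)
  then show ?thesis
    by (simp add: char_roots_vieta[OF assms])
qed

end

theory Submission
  imports Defs
begin

text \<open>
  The companion \<open>V n = \<alpha> L n\<close> satisfies \<open>V n = 2 F (n + 1) - d F n\<close> and
  \<open>(d\<^sup>2 + 4 g) F n = 2 V (n + 1) - d V n\<close>. For constant \<open>g\<close>, the identity \<open>V' n = n d' F n\<close>
  follows from the recurrence, and differentiating the second relation then yields \<open>F' n\<close>,
  with no further induction.
\<close>

text \<open>Both sides satisfy the same second-order recurrence. The hypotheses on \<open>c\<close>
  prescribe the initial values 2 and \<open>d\<close>, which the right side also takes at 0 and
  1.\<close>

lemma scaled_lucas_eq_fibonacci: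
  assumes "c * [:p0:] = 2" "c * p1 = d"
  shows "c * lucas p0 p1 d g n = 2 * fibonacci d g (n + 1) - d * fibonacci d g n"
  using assms
proof (induction p0 p1 d g n rule: lucas.induct)
  case (3 p0 p1 d g n)
  have "c * lucas p0 p1 d g (Suc (Suc n)) =
      d * (c * lucas p0 p1 d g (Suc n)) + g * (c * lucas p0 p1 d g n)"
    by (simp add: algebra_simps)
  also have "\<dots> = 2 * fibonacci d g (Suc (Suc n) + 1) - d * fibonacci d g (Suc (Suc n))"
    unfolding "3.IH"[OF "3.prems"] by (simp add: algebra_simps)
  finally show ?case .
qed simp_all

text \<open>Expanding \<open>F (n + 2)\<close> by the recurrence, the multiples of
  \<open>d * F (n + 1)\<close> cancel and only \<open>F n\<close> survives.\<close>

lemma discriminant_mult_fibonacci: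
  assumes "c * [:p0:] = 2" "c * p1 = d"
  shows "(d\<^sup>2 + 4 * g) * fibonacci d g n =
    2 * (c * lucas p0 p1 d g (n + 1)) - d * (c * lucas p0 p1 d g n)"
  unfolding scaled_lucas_eq_fibonacci[OF assms]
  by (simp add: algebra_simps power2_eq_square)

lemma pderiv_scaled_lucas:
  assumes "c * [:p0:] = 2" "c * p1 = d" "pderiv g = 0"
  shows "pderiv (c * lucas p0 p1 d g n) = of_nat n * pderiv d * fibonacci d g n"
  using assms
proof (induction p0 p1 d g n rule: lucas.induct)
  case (3 p0 p1 d g n)
  let ?V = "\<lambda>n. c * lucas p0 p1 d g n" and ?F = "fibonacci d g"
  have "?V (Suc (Suc n)) = d * ?V (n + 1) + g * ?V n"
    by (simp add: algebra_simps)
  then have "pderiv (?V (Suc (Suc n))) =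
      pderiv d * ?V (n + 1) + d * pderiv (?V (n + 1)) + g * pderiv (?V n)"
    by (simp add: pderiv_add pderiv_mult[of d] pderiv_mult[of g] 3 del: lucas.simps)
  \<comment> \<open>Writing \<open>V (n + 1)\<close> through \<open>F\<close> removes one of the
    \<open>n + 1\<close> copies of \<open>d * F (n + 1)\<close>. The remaining \<open>n\<close>
    copies combine with \<open>n * g * F n\<close> to \<open>n * F (n + 2)\<close>.\<close>
  also have "\<dots> = pderiv d * (2 * ?F (n + 2) - d * ?F (n + 1))
      + d * (of_nat (n + 1) * pderiv d * ?F (n + 1)) + g * (of_nat n * pderiv d * ?F n)"
    using scaled_lucas_eq_fibonacci[OF 3(3,4), of g "n + 1"] 3 by simp
  also have "\<dots> = of_nat (Suc (Suc n)) * pderiv d * ?F (Suc (Suc n))"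
    by (simp add: algebra_simps)
  finally show ?case .
qed auto

lemma discriminant_mult_pderiv_fibonacci:
  assumes "c * [:p0:] = 2" "c * p1 = d" "pderiv g = 0"
  shows "(d\<^sup>2 + 4 * g) * pderiv (fibonacci d g n) =
    pderiv d * (of_nat n * (c * lucas p0 p1 d g n) - d * fibonacci d g n)"
proof -
  let ?V = "\<lambda>n. c * lucas p0 p1 d g n" and ?F = "fibonacci d g"
  have two: "pderiv (2 * p) = 2 * pderiv p" for p :: "rat poly"
    unfolding mult_2 by (rule pderiv_add)
  \<comment> \<open>Constancy of \<open>g\<close> enters here a second time, besides its use for the
    derivative of \<open>V\<close>.\<close>
  have disc: "pderiv (d\<^sup>2 + 4 * g) = 2 * d * pderiv d"
    by (simp add: pderiv_add pderiv_smult numeral_poly assms(3) power2_eq_square pderiv_mult)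
  have V: "?V n = 2 * ?F (n + 1) - d * ?F n"
    using assms(1,2) by (rule scaled_lucas_eq_fibonacci)
  have "pderiv ((d\<^sup>2 + 4 * g) * ?F n) = 2 * pderiv (?V (n + 1)) - pderiv (d * ?V n)"
    by (simp only: discriminant_mult_fibonacci[OF assms(1,2)] pderiv_diff two)
  then have "(d\<^sup>2 + 4 * g) * pderiv (?F n) + ?F n * (2 * d * pderiv d) =
      2 * (of_nat (n + 1) * pderiv d * ?F (n + 1))
      - (d * (of_nat n * pderiv d * ?F n) + ?V n * pderiv d)"
    by (simp only: pderiv_mult[of "d\<^sup>2 + 4 * g"] pderiv_mult[of d] disc pderiv_scaled_lucas[OF assms])
  then show ?thesis
    unfolding V by (simp add: algebra_simps eq_diff_eq)
qed

text \<open>The square of \<open>d\<close> dominates: its degree is twice that of \<open>d\<close>,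
  hence positive and above that of \<open>4 * g\<close>, so the leading term cannot cancel.\<close>

lemma discriminant_nonzero:
  fixes d g :: "rat poly"
  assumes "degree g < degree d"
  shows "d\<^sup>2 + 4 * g \<noteq> 0"
proof -
  have "degree (4 * g) < degree (d\<^sup>2)"
    using assms degree_mult_le[of 4 g] by (subst degree_power_eq) auto
  then have "degree (d\<^sup>2 + 4 * g) = degree (d\<^sup>2)"
    by (rule degree_add_eq_left)
  with assms show ?thesis
    by (cases "d = 0") (auto simp: degree_power_eq)
qed

theorem theorem18:
  fixes p0 :: rat and \<alpha> :: int and p1 d g :: "rat poly"
    and a b :: "rat poly fract alg_closure"
    and L F :: "nat \<Rightarrow> rat poly" and n :: nat
  assumes "lucas_type p0 \<alpha> p1 d g"
    and L: "L = lucas p0 p1 d g"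
    and F: "F = fibonacci d g"
    and "char_roots d g = {a, b}"
    and "gcd d g = 1"
    and "degree g < degree d"
    and "gcd [:p0:] p1 = 1"
    and "gcd [:p0:] d = 1"
    and "gcd [:p0:] g = 1"
    and "degree (L 1) \<ge> 1"
    and "degree g = 0"
    and "n \<ge> 1"
  shows "emb (pderiv (F n)) =
           emb (pderiv d * (of_nat n * g * F (n - 1) - d * F n + of_nat n * F (n + 1))) / (a - b)\<^sup>2 \<and>
         emb (pderiv d * (of_nat n * g * F (n - 1) - d * F n + of_nat n * F (n + 1))) / (a - b)\<^sup>2 =
           emb (pderiv d * (of_nat n * of_int \<alpha> * L n - d * F n)) / (a - b)\<^sup>2 \<and>
         pderiv (L n) = smult (1 / of_int \<alpha>) (of_nat n * pderiv d * F n)"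
proof -
  let ?c = "of_int \<alpha> :: rat poly"
  have \<alpha>: "of_int \<alpha> * p0 = 2" and c1: "?c * p1 = d"
    using assms(1) by (auto simp: lucas_type_def)
  have \<alpha>0: "of_int \<alpha> \<noteq> (0::rat)"
    using \<alpha> by auto
  have c_smult: "?c * q = smult (of_int \<alpha>) q" for q
    by (simp add: of_int_poly)
  have c0: "?c * [:p0:] = 2"
    by (simp add: c_smult \<alpha> numeral_poly del: mult_pCons_right)
  have g': "pderiv g = 0"
    using \<open>degree g = 0\<close> by (simp add: pderiv_eq_0_iff)
  \<comment> \<open>With truncated subtraction the identity
    \<open>V n = g * F (n - 1) + F (n + 1)\<close> fails at \<open>n = 0\<close>, where it would
    read 2 = 1.\<close>
  obtain m where m: "n = Suc m"
    using \<open>n \<ge> 1\<close> by (cases n) auto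
  have V: "?c * L n = g * F (n - 1) + F (n + 1)"
    unfolding L F scaled_lucas_eq_fibonacci[OF c0 c1] by (simp add: m algebra_simps)
  have num: "of_nat n * g * F (n - 1) - d * F n + of_nat n * F (n + 1) =
      of_nat n * ?c * L n - d * F n"
    unfolding mult.assoc V by (simp add: algebra_simps)
  have "emb ((d\<^sup>2 + 4 * g) * pderiv (F n)) = emb (pderiv d * (of_nat n * ?c * L n - d * F n))"
    using discriminant_mult_pderiv_fibonacci[OF c0 c1 g', of n]
    by (simp only: L F mult.assoc)
  \<comment> \<open>Injectivity of \<open>emb\<close> makes \<open>(a - b)\<^sup>2\<close> nonzero,
    so the quotient below is a true one and not the default value of division by zero.\<close>
  moreover have "emb (d\<^sup>2 + 4 * g) \<noteq> 0"
    using discriminant_nonzero[OF \<open>degree g < degree d\<close>] by (metis emb_eq_iff emb_simps(1))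
  ultimately have "emb (pderiv (F n)) =
      emb (pderiv d * (of_nat n * ?c * L n - d * F n)) / (a - b)\<^sup>2"
    unfolding char_roots_diff_square[OF \<open>char_roots d g = {a, b}\<close>] emb_simps(6)[of "d\<^sup>2 + 4 * g"]
    by (metis nonzero_mult_div_cancel_left)
  \<comment> \<open>As a nonzero rational scalar, \<open>\<alpha>\<close> passes through the
    derivative and can be divided out.\<close>
  moreover have "pderiv (L n) = smult (1 / of_int \<alpha>) (of_nat n * pderiv d * F n)"
    using pderiv_scaled_lucas[OF c0 c1 g', of n, symmetric] \<alpha>0
    by (simp add: L F c_smult pderiv_smult)
  ultimately show ?thesis
    unfolding num by simp
qed

end
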